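(* Let $f:[0,1]\to\mathbb{R}$ be the continuous function defined by $$f(x)=\delta_{\alpha_1(x)1}+\sum_{k=2}^{\infty}\left[\delta_{\alpha_k(x)k}\prod_{j=1}^{k-1}g_{\alpha_j(x)j}\right]\quad\text{for } x=\Delta^{Q_3^*}_{\alpha_1(x)\alpha_2(x)\ldots\alpha_k(x)\ldots}.$$ If $\frac12<\varepsilon_k\le1$ for every $k\in\mathbb{N}$, then $f$ is nowhere monotonic, i.e. there is no nonempty open interval $(a,b)\subset[0,1]$ on which $f$ is monotone.
   Context: Let $\|q_{ik}\|$ ($i\in\{0,1,2\}$, $k\in\mathbb{N}=\{1,2,\ldots\}$) be an infinite matrix with $q_{ik}>0$ and $q_{0k}+q_{1k}+q_{2k}=1$ for all $k$. Put $\beta_{0k}=0$, $\beta_{1k}=q_{0k}$, $\beta_{2k}=q_{0k}+q_{1k}$. For a sequence $(\alpha_k)$ with $\alpha_k\in\{0,1,2\}$ write $$\Delta^{Q_3^*}_{\alpha_1\alpha_2\ldots\alpha_k\ldots}=\beta_{\alpha_1 1}+\sum_{k=2}^{\infty}\Big[\beta_{\alpha_k k}\prod_{j=1}^{k-1}q_{\alpha_j j}\Big].$$ The matrix is assumed to define a representation of numbers, i.e. every $x\in[0,1]$ equals $\Delta^{Q_3^*}_{\alpha_1\alpha_2\ldots}$ for some sequence $\alpha_k=\alpha_k(x)$. Let $(\varepsilon_k)_{k\ge1}$ be a sequence of real numbers with $0\le\varepsilon_k\le1$. Put $g_{0k}=g_{2k}=\frac{1+\varepsilon_k}{3}$, $g_{1k}=\frac{1-2\varepsilon_k}{3}$,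 $\delta_{0k}=0$, $\delta_{1k}=g_{0k}$, $\delta_{2k}=g_{0k}+g_{1k}$. The value $f(x)$ does not depend on the choice of representation when $x$ has two representations. *)

theory Defs
  imports Complex_Main
begin

text \<open>
  Matrices are curried as \<open>q i k\<close>, with row \<open>i \<in> {0, 1, 2}\<close> and column \<open>k \<ge> 1\<close>;
  entries in column \<open>0\<close>, and the term \<open>\<alpha> 0\<close> of a digit sequence, are never used.
\<close>

definition digit_seq :: "(nat \<Rightarrow> nat) \<Rightarrow> bool" where
  "digit_seq \<alpha> \<longleftrightarrow> (\<forall>k\<ge>1. \<alpha> k \<in> {0, 1, 2})"

definition col_offset :: "(nat \<Rightarrow> nat \<Rightarrow> real) \<Rightarrow> nat \<Rightarrow> nat \<Rightarrow> real" where
  "col_offset q i k = (\<Sum>l<i. q l k)"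

text \<open>
  For \<open>m = q\<close> this is \<open>\<Delta>\<close> applied to the digits \<open>\<alpha>\<close>, where \<open>col_offset q i k\<close> is \<open>\<beta>\<^sub>i\<^sub>k\<close>; for
  \<open>m = g_matrix \<epsilon>\<close> it is the series defining the function, where \<open>col_offset m i k\<close> is
  \<open>\<delta>\<^sub>i\<^sub>k\<close>. The summation index is shifted so that \<open>k = 0\<close> stands for position \<open>2\<close>.
  The series converges in both cases: for \<open>q\<close> its terms are nonnegative with partial sums at
  most \<open>1\<close>; for \<open>0 \<le> \<epsilon>\<^sub>k \<le> 1\<close> the entries of \<open>g_matrix \<epsilon>\<close> are at most \<open>2/3\<close> in absolute value.
\<close>
definition expansion :: "(nat \<Rightarrow> nat \<Rightarrow> real) \<Rightarrow> (nat \<Rightarrow> nat) \<Rightarrow> real" where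
  "expansion m \<alpha> = col_offset m (\<alpha> 1) 1
     + (\<Sum>k. col_offset m (\<alpha> (k + 2)) (k + 2) * (\<Prod>j = 1..k + 1. m (\<alpha> j) j))"

definition Q3_matrix :: "(nat \<Rightarrow> nat \<Rightarrow> real) \<Rightarrow> bool" where
  "Q3_matrix q \<longleftrightarrow>
     (\<forall>k\<ge>1. (\<forall>i\<in>{0, 1, 2}. q i k > 0) \<and> q 0 k + q 1 k + q 2 k = 1) \<and>
     (\<forall>x\<in>{0..1}. \<exists>\<alpha>. digit_seq \<alpha> \<and> x = expansion q \<alpha>)"

definition g_matrix :: "(nat \<Rightarrow> real) \<Rightarrow> nat \<Rightarrow> nat \<Rightarrow> real" where
  "g_matrix \<epsilon> i k = (if i = 1 then (1 - 2 * \<epsilon> k) / 3 else (1 + \<epsilon> k) / 3)"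

end

theory Submission imports Defs begin

text \<open>
  Fix the first \<open>n\<close> digits. The numbers starting with them fill an interval, a cylinder of rank
  \<open>n\<close>; call the terms of a digit sequence up to position \<open>n\<close> its partial expansion, which is the left
  endpoint of the cylinder, and the product of the matrix entries its weight, which is the length.
  Continuing by the digits \<open>0, 1, 2\<close> and then by zeros gives three points \<open>x0 < x1 < x2\<close> of the
  cylinder. If \<open>G\<close> is the weight of the same digits for the matrix \<open>g\<close>, then
  \<open>f x1 - f x0 = G * g 0 (n + 1)\<close> and \<open>f x2 - f x1 = G * g 1 (n + 1)\<close>. For \<open>\<epsilon> > 1/2\<close> the entries
  in row \<open>1\<close> are negative and the others positive, so \<open>G\<close> is nonzero and the two increments have
  opposite signs: \<open>f\<close> is not monotonic on any cylinder.

  It remains to see that each open interval contains a cylinder. One might shrink the cylinders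
  around a point of the interval, but that needs their lengths to tend to zero. Instead, the partial
  expansions of a number converge to it from below, so every interval contains two left endpoints
  \<open>z < z'\<close>, and padding with zeros makes their ranks equal
  (\<open>partial_expansion_in_interval\<close>). Cylinders of equal rank coincide or do not overlap
  (\<open>cylinders_equal_or_separated\<close>), so the cylinder that starts at \<open>z\<close> ends no later than \<open>z'\<close>.
\<close>

section \<open>Cylinders\<close>

definition weight :: "(nat \<Rightarrow> nat \<Rightarrow> real) \<Rightarrow> (nat \<Rightarrow> nat) \<Rightarrow> nat \<Rightarrow> real" where
  "weight m \<alpha> n = (\<Prod>j = 1..n. m (\<alpha> j) j)"

definition partial_expansion :: "(nat \<Rightarrow> nat \<Rightarrow> real) \<Rightarrow> (nat \<Rightarrow> nat) \<Rightarrow> nat \<Rightarrow> real" where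
  "partial_expansion m \<alpha> n = (\<Sum>k<n. col_offset m (\<alpha> (Suc k)) (Suc k) * weight m \<alpha> k)"

lemma weight_0 [simp]: "weight m \<alpha> 0 = 1"
  by (simp add: weight_def)

lemma weight_Suc [simp]: "weight m \<alpha> (Suc n) = weight m \<alpha> n * m (\<alpha> (Suc n)) (Suc n)"
  by (simp add: weight_def)

lemma partial_expansion_0 [simp]: "partial_expansion m \<alpha> 0 = 0"
  by (simp add: partial_expansion_def)

lemma partial_expansion_Suc [simp]:
  "partial_expansion m \<alpha> (Suc n) =
     partial_expansion m \<alpha> n + col_offset m (\<alpha> (Suc n)) (Suc n) * weight m \<alpha> n"
  by (simp add: partial_expansion_def)

lemma weight_cong:
  "(\<And>k. 1 \<le> k \<Longrightarrow> k \<le> n \<Longrightarrow> \<alpha> k = \<beta> k) \<Longrightarrow> weight m \<alpha> n = weight m \<beta> n"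
  by (simp add: weight_def)

lemma partial_expansion_cong:
  "(\<And>k. 1 \<le> k \<Longrightarrow> k \<le> n \<Longrightarrow> \<alpha> k = \<beta> k) \<Longrightarrow>
     partial_expansion m \<alpha> n = partial_expansion m \<beta> n"
  unfolding partial_expansion_def
  by (intro sum.cong refl arg_cong2[where f = "(*)"] weight_cong) auto

lemma col_offset_simps [simp]:
  "col_offset m 0 k = 0"
  "col_offset m (Suc 0) k = m 0 k"
  "col_offset m 2 k = m 0 k + m 1 k"
  by (simp_all add: col_offset_def numeral_2_eq_2)

lemma digit_cases:
  assumes "digit_seq \<alpha>"
  obtains "\<alpha> (Suc n) = 0" | "\<alpha> (Suc n) = Suc 0" | "\<alpha> (Suc n) = 2"
  using assms by (force simp: digit_seq_def)

lemma expansion_eq_limit: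
  assumes "partial_expansion m \<alpha> \<longlonglongrightarrow> L"
  shows "expansion m \<alpha> = L"
proof -
  let ?t = "\<lambda>k. col_offset m (\<alpha> (k + 2)) (k + 2) * (\<Prod>j = 1..k + 1. m (\<alpha> j) j)"
  have "(\<Sum>k<n. ?t k) = partial_expansion m \<alpha> (Suc n) - col_offset m (\<alpha> 1) 1" for n
    by (induction n) (simp_all add: weight_def)
  moreover have "(\<lambda>n. partial_expansion m \<alpha> (Suc n) - col_offset m (\<alpha> 1) 1)
      \<longlonglongrightarrow> L - col_offset m (\<alpha> 1) 1"
    by (intro tendsto_diff tendsto_const LIMSEQ_Suc assms)
  ultimately have "?t sums (L - col_offset m (\<alpha> 1) 1)"
    by (simp add: sums_def)
  then show ?thesis
    unfolding expansion_def by (simp add: sums_iff)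
qed

lemma partial_expansion_trailing_zeros:
  assumes "\<And>k. n < k \<Longrightarrow> \<alpha> k = 0" and "n \<le> N"
  shows "partial_expansion m \<alpha> N = partial_expansion m \<alpha> n"
  using assms(2) by (induction N rule: dec_induct) (simp_all add: assms(1))

lemma expansion_trailing_zeros:
  assumes "\<And>k. n < k \<Longrightarrow> \<alpha> k = 0"
  shows "expansion m \<alpha> = partial_expansion m \<alpha> n"
proof (rule expansion_eq_limit)
  have "\<forall>\<^sub>F N in sequentially. partial_expansion m \<alpha> N = partial_expansion m \<alpha> n"
    unfolding eventually_sequentially
    using partial_expansion_trailing_zeros[of n \<alpha>, OF assms] by blast
  then show "partial_expansion m \<alpha> \<longlonglongrightarrow> partial_expansion m \<alpha> n"
    by (rule tendsto_eventually)
qed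

section \<open>Stochastic columns\<close>

definition positive_stochastic :: "(nat \<Rightarrow> nat \<Rightarrow> real) \<Rightarrow> bool" where
  "positive_stochastic q \<longleftrightarrow>
     (\<forall>k\<ge>1. (\<forall>i\<in>{0, 1, 2}. q i k > 0) \<and> q 0 k + q 1 k + q 2 k = 1)"

lemma positive_stochastic_column:
  assumes "positive_stochastic q"
  shows "q 0 (Suc n) > 0" "q (Suc 0) (Suc n) > 0" "q 2 (Suc n) > 0"
    and "q 0 (Suc n) + q (Suc 0) (Suc n) + q 2 (Suc n) = 1"
  using assms by (auto simp: positive_stochastic_def)

lemma weight_pos:
  assumes "positive_stochastic q" "digit_seq \<alpha>"
  shows "weight q \<alpha> n > 0"
proof (induction n)
  case (Suc n)
  then show ?case
    using positive_stochastic_column[OF assms(1), of n]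
    by (cases rule: digit_cases[OF assms(2), of n]) auto
qed simp

lemma cylinder_nested:
  assumes "positive_stochastic q" "digit_seq \<alpha>"
  shows "partial_expansion q \<alpha> n \<le> partial_expansion q \<alpha> (Suc n)"
    and "partial_expansion q \<alpha> (Suc n) + weight q \<alpha> (Suc n)
           \<le> partial_expansion q \<alpha> n + weight q \<alpha> n"
proof -
  let ?i = "\<alpha> (Suc n)"
  have "0 \<le> col_offset q ?i (Suc n)" and *: "col_offset q ?i (Suc n) + q ?i (Suc n) \<le> 1"
    using positive_stochastic_column[OF assms(1), of n]
    by (cases rule: digit_cases[OF assms(2), of n]; simp)+
  then show "partial_expansion q \<alpha> n \<le> partial_expansion q \<alpha> (Suc n)"
    using weight_pos[OF assms, of n] by simp
  show "partial_expansion q \<alpha> (Suc n) + weight q \<alpha> (Suc n)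
      \<le> partial_expansion q \<alpha> n + weight q \<alpha> n"
    using mult_right_mono[OF *, of "weight q \<alpha> n"] weight_pos[OF assms, of n]
    by (simp add: algebra_simps)
qed

text \<open>
  The partial expansions increase, and they are bounded since all cylinders lie in the one of rank
  \<open>0\<close>, which is the unit interval.
\<close>
lemma partial_expansion_increases_to_expansion:
  assumes "positive_stochastic q" "digit_seq \<alpha>"
  shows "partial_expansion q \<alpha> \<longlonglongrightarrow> expansion q \<alpha>"
    and "partial_expansion q \<alpha> n \<le> expansion q \<alpha>"
proof -
  have inc: "incseq (partial_expansion q \<alpha>)"
    using cylinder_nested(1)[OF assms] by (simp add: incseq_Suc_iff)
  have "partial_expansion q \<alpha> n + weight q \<alpha> n \<le> 1" for n
  proof (induction n)
    case (Suc n)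
    then show ?case using cylinder_nested(2)[OF assms, of n] by linarith
  qed simp
  then have "partial_expansion q \<alpha> n \<le> 1" for n
    using weight_pos[OF assms, of n] by (smt (verit))
  then obtain L where L: "partial_expansion q \<alpha> \<longlonglongrightarrow> L" "\<forall>n. partial_expansion q \<alpha> n \<le> L"
    using incseq_convergent[OF inc] by blast
  then show "partial_expansion q \<alpha> \<longlonglongrightarrow> expansion q \<alpha>"
      and "partial_expansion q \<alpha> n \<le> expansion q \<alpha>"
    using expansion_eq_limit[OF L(1)] by simp_all
qed

lemma partial_expansion_in_interval:
  assumes "Q3_matrix q" and "a < b" "{a<..<b} \<subseteq> {0..1}"
  obtains \<alpha> n where "digit_seq \<alpha>" "\<And>k. n < k \<Longrightarrow> \<alpha> k = 0"
    and "partial_expansion q \<alpha> n \<in> {a<..<b}"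
proof -
  have q: "positive_stochastic q"
    using assms(1) by (simp add: Q3_matrix_def positive_stochastic_def)
  obtain x where x: "a < x" "x < b"
    using dense[OF assms(2)] by blast
  then have "x \<in> {0..1}"
    using assms(3) by auto
  then obtain \<alpha> where \<alpha>: "digit_seq \<alpha>" "x = expansion q \<alpha>"
    using assms(1) unfolding Q3_matrix_def by blast
  have "\<forall>\<^sub>F n in sequentially. a < partial_expansion q \<alpha> n"
    using order_tendstoD(1)[OF partial_expansion_increases_to_expansion(1)[OF q \<alpha>(1)]] x \<alpha>(2)
    by simp
  then obtain n where n: "a < partial_expansion q \<alpha> n"
    using eventually_happens'[OF sequentially_bot] by blast
  define \<beta> where "\<beta> k = (if k \<le> n then \<alpha> k else 0)" for k
  have "digit_seq \<beta>"
    using \<alpha>(1) by (simp add: \<beta>_def digit_seq_def)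
  moreover have "\<beta> k = 0" if "n < k" for k
    using that by (simp add: \<beta>_def)
  moreover have "partial_expansion q \<beta> n = partial_expansion q \<alpha> n"
    by (rule partial_expansion_cong) (simp add: \<beta>_def)
  ultimately show ?thesis
    using that n partial_expansion_increases_to_expansion(2)[OF q \<alpha>(1), of n] x \<alpha>(2) by force
qed

text \<open>
  By induction on the rank. Separated cylinders stay separated when they shrink, and a cylinder is
  cut into three parts lying side by side. The alternative of equality has to include the
  weights, since only a common left endpoint together with a common length makes the subdivisions
  of the two cylinders agree.
\<close>
lemma cylinders_equal_or_separated:
  assumes "positive_stochastic q" "digit_seq \<alpha>" "digit_seq \<beta>"
  shows "partial_expansion q \<alpha> n + weight q \<alpha> n \<le> partial_expansion q \<beta> n
    \<or> partial_expansion q \<beta> n + weight q \<beta> n \<le> partial_expansion q \<alpha> n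
    \<or> partial_expansion q \<alpha> n = partial_expansion q \<beta> n \<and> weight q \<alpha> n = weight q \<beta> n"
proof (induction n)
  case (Suc n)
  note nested = cylinder_nested[OF assms(1,2), of n] cylinder_nested[OF assms(1,3), of n]
  from Suc consider
      "partial_expansion q \<alpha> n + weight q \<alpha> n \<le> partial_expansion q \<beta> n"
    | "partial_expansion q \<beta> n + weight q \<beta> n \<le> partial_expansion q \<alpha> n"
    | "partial_expansion q \<alpha> n = partial_expansion q \<beta> n" "weight q \<alpha> n = weight q \<beta> n"
    by blast
  then show ?case
  proof cases
    case 3
    have "0 < weight q \<beta> n * q 0 (Suc n)" "0 < weight q \<beta> n * q (Suc 0) (Suc n)"
      using positive_stochastic_column[OF assms(1), of n] weight_pos[OF assms(1,3), of n]
      by simp_all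
    then show ?thesis
      using 3
      by (cases rule: digit_cases[OF assms(2), of n]; cases rule: digit_cases[OF assms(3), of n])
         (simp_all add: algebra_simps)
  qed (use nested in linarith)+
qed simp

section \<open>Oscillation on a cylinder\<close>

definition replace_tail :: "nat \<Rightarrow> nat \<Rightarrow> (nat \<Rightarrow> nat) \<Rightarrow> nat \<Rightarrow> nat" where
  "replace_tail n i \<alpha> k = (if k \<le> n then \<alpha> k else if k = Suc n then i else 0)"

lemma digit_seq_replace_tail:
  "digit_seq \<alpha> \<Longrightarrow> i \<in> {0, 1, 2} \<Longrightarrow> digit_seq (replace_tail n i \<alpha>)"
  by (auto simp: digit_seq_def replace_tail_def)

lemma expansion_replace_tail:
  "expansion m (replace_tail n i \<alpha>) =
     partial_expansion m \<alpha> n + col_offset m i (Suc n) * weight m \<alpha> n"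
proof -
  have "expansion m (replace_tail n i \<alpha>) = partial_expansion m (replace_tail n i \<alpha>) (Suc n)"
    by (rule expansion_trailing_zeros) (simp add: replace_tail_def)
  moreover have "weight m (replace_tail n i \<alpha>) n = weight m \<alpha> n"
    by (rule weight_cong) (simp add: replace_tail_def)
  moreover have "partial_expansion m (replace_tail n i \<alpha>) n = partial_expansion m \<alpha> n"
    by (rule partial_expansion_cong) (simp add: replace_tail_def)
  ultimately show ?thesis
    by (simp add: replace_tail_def)
qed

lemma weight_g_matrix_nonzero:
  assumes "\<forall>k\<ge>1. 1 / 2 < \<epsilon> k"
  shows "weight (g_matrix \<epsilon>) \<alpha> n \<noteq> 0"
proof -
  have "g_matrix \<epsilon> i k \<noteq> 0" if "k \<ge> 1" for i k
    using assms that by (auto simp: g_matrix_def dest!: spec[of _ k])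
  then show ?thesis
    by (simp add: weight_def)
qed

lemma not_monotone_if_oscillates:
  fixes f :: "real \<Rightarrow> real"
  assumes "x \<in> S" "y \<in> S" "z \<in> S" "x < y" "y < z"
    and "(f y - f x) * (f z - f y) < 0"
  shows "\<not> (mono_on S f \<or> antimono_on S f)"
proof
  assume "mono_on S f \<or> antimono_on S f"
  then have "f x \<le> f y \<and> f y \<le> f z \<or> f x \<ge> f y \<and> f y \<ge> f z"
    using assms by (auto simp: monotone_on_def)
  then show False
    using assms(6) by (auto simp: mult_less_0_iff)
qed

theorem theorem3:
  fixes q :: "nat \<Rightarrow> nat \<Rightarrow> real" and \<epsilon> :: "nat \<Rightarrow> real" and f :: "real \<Rightarrow> real"
  assumes "Q3_matrix q"
    and "\<forall>k\<ge>1. 0 \<le> \<epsilon> k \<and> \<epsilon> k \<le> 1"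
    and "continuous_on {0..1} f"
    and "\<forall>x\<in>{0..1}. \<forall>\<alpha>. digit_seq \<alpha> \<and> x = expansion q \<alpha> \<longrightarrow> f x = expansion (g_matrix \<epsilon>) \<alpha>"
    and "\<forall>k\<ge>1. 1 / 2 < \<epsilon> k \<and> \<epsilon> k \<le> 1"
  shows "\<not> (\<exists>a b. a < b \<and> {a<..<b} \<subseteq> {0..1} \<and>
            (mono_on {a<..<b} f \<or> antimono_on {a<..<b} f))"
proof -
  have q: "positive_stochastic q"
    using assms(1) by (simp add: Q3_matrix_def positive_stochastic_def)
  have "\<not> (mono_on {a<..<b} f \<or> antimono_on {a<..<b} f)"
    if ab: "a < b" "{a<..<b} \<subseteq> {0..1}" for a b
  proof -
    obtain \<alpha> m where \<alpha>: "digit_seq \<alpha>" "\<And>k. m < k \<Longrightarrow> \<alpha> k = 0"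
        "partial_expansion q \<alpha> m \<in> {a<..<b}"
      using partial_expansion_in_interval[OF assms(1) ab] by blast
    then have "partial_expansion q \<alpha> m < b" "{partial_expansion q \<alpha> m<..<b} \<subseteq> {0..1}"
      using ab(2) by auto
    then obtain \<beta> l where \<beta>: "digit_seq \<beta>" "\<And>k. l < k \<Longrightarrow> \<beta> k = 0"
        "partial_expansion q \<beta> l \<in> {partial_expansion q \<alpha> m<..<b}"
      using partial_expansion_in_interval[OF assms(1)] by metis
    define n where "n = max m l"
    define z w where "z = partial_expansion q \<alpha> n" and "w = weight q \<alpha> n"
    have z: "z = partial_expansion q \<alpha> m"
      unfolding z_def by (rule partial_expansion_trailing_zeros) (simp_all add: \<alpha> n_def)
    have z': "partial_expansion q \<beta> n = partial_expansion q \<beta> l"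
      by (rule partial_expansion_trailing_zeros) (simp_all add: \<beta> n_def)
    have "a < z" and "z < partial_expansion q \<beta> n" and "partial_expansion q \<beta> n < b"
      using \<alpha>(3) \<beta>(3) by (simp_all add: z z')
    \<comment> \<open>The cylinders of \<open>\<alpha>\<close> and \<open>\<beta>\<close> have equal rank and distinct left endpoints, so that of
      \<open>\<alpha>\<close> is over before that of \<open>\<beta>\<close> begins; the interval contains it whole.\<close>
    then have zw: "a < z" "z + w < b"
      using cylinders_equal_or_separated[OF q \<alpha>(1) \<beta>(1), of n] weight_pos[OF q \<beta>(1), of n]
      unfolding z_def w_def by linarith+
    define G where "G = weight (g_matrix \<epsilon>) \<alpha> n"
    define x where "x i = z + col_offset q i (Suc n) * w" for i
    have w: "w > 0"
      unfolding w_def by (rule weight_pos[OF q \<alpha>(1)])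
    note col = positive_stochastic_column[OF q, of n]
    have x_less: "x 0 < x 1" "x 1 < x 2"
      using w col by (simp_all add: x_def)
    have "(q 0 (Suc n) + q 1 (Suc n)) * w < 1 * w"
      using w col by (intro mult_strict_right_mono) simp_all
    then have "x 2 < b"
      using zw by (simp add: x_def)
    moreover have "a < x 0"
      using zw by (simp add: x_def)
    ultimately have x_in: "x i \<in> {a<..<b}" if "i \<in> {0, 1, 2}" for i
      using that x_less by force
    have f: "f (x i) = partial_expansion (g_matrix \<epsilon>) \<alpha> n + col_offset (g_matrix \<epsilon>) i (Suc n) * G"
      if "i \<in> {0, 1, 2}" for i
    proof -
      have "x i \<in> {0..1}"
        using x_in[OF that] ab(2) by blast
      moreover have "x i = expansion q (replace_tail n i \<alpha>)"
        by (simp add: x_def z_def w_def expansion_replace_tail)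
      ultimately have "f (x i) = expansion (g_matrix \<epsilon>) (replace_tail n i \<alpha>)"
        using assms(4) digit_seq_replace_tail[OF \<alpha>(1) that] by blast
      then show ?thesis
        by (simp add: expansion_replace_tail G_def)
    qed
    have \<epsilon>: "1 / 2 < \<epsilon> (Suc n)"
      using assms(5) by simp
    have "G \<noteq> 0"
      unfolding G_def using assms(5) by (intro weight_g_matrix_nonzero) blast
    moreover have "g_matrix \<epsilon> 0 (Suc n) * g_matrix \<epsilon> 1 (Suc n) < 0"
      using \<epsilon> by (intro mult_pos_neg) (simp_all add: g_matrix_def)
    ultimately have "G\<^sup>2 * (g_matrix \<epsilon> 0 (Suc n) * g_matrix \<epsilon> 1 (Suc n)) < 0"
      by (simp only: mult_less_0_iff zero_less_power2 simp_thms)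
    then have "(f (x 1) - f (x 0)) * (f (x 2) - f (x 1)) < 0"
      by (simp add: f algebra_simps power2_eq_square)
    then show ?thesis
      using not_monotone_if_oscillates x_in x_less by blast
  qed
  then show ?thesis
    by blast
qed

end
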